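(* Assume that the moving point sets $P(t)$ have diameter $D(t)\ge 1$ for all $t$ and that the points move with at most unit speed. Then the $K$-Lipschitz stability ratios (for $K=43$) of the oriented bounding box (OBB) and the covering strip (STRIP) satisfy $$\rho_{LS}(\text{OBB},43)\le 18,\qquad \rho_{LS}(\text{STRIP},43)\le 18 .$$
   Context: A moving point set is $P(t)=\{p_1(t),\dots,p_n(t)\}$, $t\in[0,T]$, with $n$ any finite number of points and each $p_i:[0,T]\to\mathbb{R}^2$ continuous; "at most unit speed" means each $p_i$ is $1$-Lipschitz. The diameter $D(t)$ is the maximum distance between two points of $P(t)$. An orientation is an element of the real projective line $\mathbb{RP}^1$, represented by a unit vector $\alpha\in\mathbb{R}^2$ with opposite vectors identified; the distance between orientations is the angle between them in radians (orientations are angles modulo $\pi$). Let $\alpha^\perp$ be the orientation orthogonal to $\alpha$ and $w_\alpha(P)=\max_{p,q\in P}(p-q)\cdot\alpha$. The cost functions are $f_{\text{OBB}}(\alpha,P)=w_\alpha(P)\,w_{\alpha^\perp}(P)$ and $f_{\text{STRIP}}(\alpha,P)=w_{\alpha^\perp}(P)$. A state-aware algorithm $\mathcal{A}$ produces, for a moving point set, an orientation at every time $t$; it has access to the input $P(t)$ at the current time and maintains a state over time (such as its earlier output). It has no knowledge of future inputs. The output at time $t$ is denoted $\mathcal{A}(P(t))$, the state being implicit. The $K$-Lipschitz stability ratio of a shape descriptor $\Pi$ is $$\rho_{LS}(\Pi,K)=\inf_{\mathcal{A}}\sup_{P(t)}\max_{t\in[0,T]}\frac{f_\Pi(\mathcal{A}(P(t)),P(t))}{\min_\gamma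 f_\Pi(\gamma,P(t))},$$ where the supremum is over all moving point sets satisfying the speed and diameter assumptions, and the infimum is over all (state-aware) algorithms for which $\mathcal{A}(P(t))$ is $K$-Lipschitz in $t$, i.e. the output orientation moves continuously at a speed of at most $K$ radians per time unit. Convention: if the minimum cost is $0$, the ratio is $1$ if the numerator is $0$ and $\infty$ otherwise. *)

theory Defs
  imports "HOL-Analysis.Analysis"
begin

section \<open>Orientations\<close>

text \<open>The real projective line: unit vectors of the plane with opposite vectors identified.\<close>

quotient_type orientation =
  "real^2" / partial: "\<lambda>u v. norm u = 1 \<and> norm v = 1 \<and> (u = v \<or> u = - v)"
proof (rule part_equivpI)
  show "\<exists>u::real^2. norm u = 1 \<and> norm u = 1 \<and> (u = u \<or> u = - u)"
    by (rule exI[of _ "axis 1 1"]) simp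
qed (auto simp: symp_def transp_def)

text \<open>The angle between the two lines, which lies between 0 and \<open>pi / 2\<close>; it is the smaller of
  the angles that \<open>u\<close> forms with \<open>v\<close> and with \<open>- v\<close>.\<close>

lift_definition orientation_dist :: "orientation \<Rightarrow> orientation \<Rightarrow> real"
  is "\<lambda>u v. arccos \<bar>u \<bullet> v\<bar>"
  by auto

lift_definition perp :: "orientation \<Rightarrow> orientation"
  is "\<lambda>u. vector [- (u $ 2), u $ 1]"
  by (auto simp: norm_eq_1 inner_vec_def sum_2 vec_eq_iff forall_2 add.commute)

lemma extents_uminus:
  fixes u :: "real^2"
  shows "{(p - q) \<bullet> (- u) | p q. p \<in> P \<and> q \<in> P} = {(p - q) \<bullet> u | p q. p \<in> P \<and> q \<in> P}"
proof -
  have "(p - q) \<bullet> (- u) = (q - p) \<bullet> u" for p q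
    by (simp add: inner_diff_left)
  then show ?thesis
    by (simp only:) blast
qed

lift_definition width :: "orientation \<Rightarrow> (real^2) set \<Rightarrow> real"
  is "\<lambda>u P. Max {(p - q) \<bullet> u | p q. p \<in> P \<and> q \<in> P}"
  by (auto simp only: extents_uminus)

section \<open>Cost functions\<close>

definition cost_OBB :: "orientation \<Rightarrow> (real^2) set \<Rightarrow> real" where
  "cost_OBB \<alpha> P = width \<alpha> P * width (perp \<alpha>) P"

definition cost_STRIP :: "orientation \<Rightarrow> (real^2) set \<Rightarrow> real" where
  "cost_STRIP \<alpha> P = width (perp \<alpha>) P"

text \<open>For the two costs above and a nonempty finite \<open>P\<close> the infimum over all orientations is a
  minimum, since the cost is continuous on a compact space.\<close>

definition cost_ratio ::
  "(orientation \<Rightarrow> (real^2) set \<Rightarrow> real) \<Rightarrow> orientation \<Rightarrow> (real^2) set \<Rightarrow> ereal" where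
  "cost_ratio f \<alpha> P =
    (let m = (INF \<gamma>. f \<gamma> P) in
     if m = 0 then (if f \<alpha> P = 0 then 1 else \<infinity>) else ereal (f \<alpha> P / m))"

section \<open>Moving point sets\<close>

definition points_at :: "nat \<Rightarrow> (nat \<Rightarrow> real \<Rightarrow> real^2) \<Rightarrow> real \<Rightarrow> (real^2) set" where
  "points_at n p t = (\<lambda>i. p i t) ` {..<n}"

text \<open>The time horizon is \<open>T\<close>; values of the trajectories outside \<open>{0..T}\<close> are irrelevant.
  Continuity of the trajectories is implied by the speed bound. On finite nonempty sets,
  \<^const>\<open>diameter\<close> is the maximum distance; it is 0 on the empty set, so \<open>n \<ge> 2\<close> follows.\<close>

definition admissible_motion :: "real \<Rightarrow> nat \<Rightarrow> (nat \<Rightarrow> real \<Rightarrow> real^2) \<Rightarrow> bool" where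
  "admissible_motion T n p \<longleftrightarrow>
    0 \<le> T \<and>
    (\<forall>i<n. 1-lipschitz_on {0..T} (p i)) \<and>
    (\<forall>t\<in>{0..T}. diameter (points_at n p t) \<ge> 1)"

section \<open>State-aware algorithms and the stability ratio\<close>

text \<open>An algorithm maps the input, given as the unlabelled point set at each time, to an
  orientation at each time. Its state may record anything about the input and output so far, so
  its output at time \<open>t\<close> may be any function of the input during \<open>{0..t}\<close>, but of nothing else:
  neither later inputs nor the time horizon are known to it.\<close>

type_synonym algorithm = "(real \<Rightarrow> (real^2) set) \<Rightarrow> real \<Rightarrow> orientation"

definition state_aware :: "algorithm \<Rightarrow> bool" where
  "state_aware A \<longleftrightarrow> (\<forall>P Q t. (\<forall>s\<in>{0..t}. P s = Q s) \<longrightarrow> A P t = A Q t)"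

definition lipschitz_algorithm :: "real \<Rightarrow> algorithm \<Rightarrow> bool" where
  "lipschitz_algorithm K A \<longleftrightarrow>
    (\<forall>T n p. admissible_motion T n p \<longrightarrow>
      (\<forall>s\<in>{0..T}. \<forall>t\<in>{0..T}.
        orientation_dist (A (points_at n p) s) (A (points_at n p) t) \<le> K * \<bar>s - t\<bar>))"

definition lipschitz_stability_ratio ::
  "(orientation \<Rightarrow> (real^2) set \<Rightarrow> real) \<Rightarrow> real \<Rightarrow> ereal" where
  "lipschitz_stability_ratio f K =
    (INF A\<in>{A. state_aware A \<and> lipschitz_algorithm K A}.
      SUP (T, n, p)\<in>{(T, n, p). admissible_motion T n p}.
        SUP t\<in>{0..T}. cost_ratio f (A (points_at n p) t) (points_at n p t))"

end

theory Submission imports Defs begin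

text \<open>Let \<open>d\<close> be the direction of a diametral pair at some time. The diagonal of the bounding box with
  axes \<open>d - pi / 4\<close> and \<open>d + pi / 4\<close> is Lipschitz in time with constant \<open>10 / 3\<close> for the next
  \<open>1 / 20\<close> time units, because the extents along the axes are Lipschitz and their sum is at least
  \<open>6 / 5\<close>. The strip along this diagonal is at most twice as wide as the thinnest strip.

  Every \<open>1 / 20\<close> time units the algorithm fixes a new diametral direction. It then follows the
  corresponding diagonal while the initial offset, at most \<open>pi / 2\<close>, decays at rate 32 and so
  vanishes before the next change. When a new diagonal is chosen, both the old and the new one give
  strips of at most twice the optimal width \<open>w\<close>, so that the offset is at most \<open>8 w\<close> divided by the
  diameter. As \<open>w\<close> decreases at rate at most 2, the offset decays fast enough to keep the
  strip within \<open>12 w\<close>. One of the two widths of any box is at least \<open>2 / 3\<close> of the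
  diameter, which turns the factor 12 for strips into 18 for boxes.\<close>

section \<open>Directions and extents\<close>

definition dir :: "real \<Rightarrow> real^2" where
  "dir \<theta> = vector [cos \<theta>, sin \<theta>]"

lemma inner_dir: "dir a \<bullet> dir b = cos (a - b)"
  by (simp add: dir_def inner_vec_def sum_2 cos_diff)

lemma norm_dir [simp]: "norm (dir a) = 1"
  by (simp add: norm_eq_1 inner_dir)

lemma dir_add: "dir (a + b) = cos b *\<^sub>R dir a + sin b *\<^sub>R dir (a + pi / 2)"
  by (simp add: dir_def vec_eq_iff forall_2 cos_add sin_add algebra_simps)

lemma dir_add_pi: "dir (a + pi) = - dir a"
  using dir_add[of a pi] by simp

lemma unit_eq_dir:
  assumes "norm u = 1"
  obtains \<theta> where "u = dir \<theta>"
proof -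
  have "(u $ 1)\<^sup>2 + (u $ 2)\<^sup>2 = 1"
    using assms by (simp add: norm_eq_1 inner_vec_def sum_2 power2_eq_square)
  then obtain t where "u $ 1 = cos t" "u $ 2 = sin t"
    by (rule sincos_total_2pi)
  then have "u = dir t"
    by (simp add: dir_def vec_eq_iff forall_2)
  then show thesis by (rule that)
qed

text \<open>The body of \<open>width\<close> on representing vectors, so that the argument can work
  with real angles instead of the quotient.\<close>

definition extent :: "real^2 \<Rightarrow> (real^2) set \<Rightarrow> real" where
  "extent u P = Max {(p - q) \<bullet> u | p q. p \<in> P \<and> q \<in> P}"

lemma extent_minus: "extent (- u) P = extent u P"
  unfolding extent_def by (simp only: extents_uminus)

lemma finite_extents:
  fixes u :: "real^2"
  assumes "finite P"
  shows "finite {(p - q) \<bullet> u | p q. p \<in> P \<and> q \<in> P}"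
  using assms finite_image_set2[of "\<lambda>p. p \<in> P" "\<lambda>q. q \<in> P" "\<lambda>p q. (p - q) \<bullet> u"] by simp

lemma extent_ge:
  assumes "finite P" "p \<in> P" "q \<in> P"
  shows "\<bar>(p - q) \<bullet> u\<bar> \<le> extent u P"
proof -
  have "(p - q) \<bullet> u \<le> extent u P" "(q - p) \<bullet> u \<le> extent u P"
    unfolding extent_def using assms finite_extents by (auto intro!: Max_ge)
  then show ?thesis by (simp add: inner_diff_left)
qed

lemma extent_attained:
  assumes "finite P" "P \<noteq> {}"
  obtains p q where "p \<in> P" "q \<in> P" "extent u P = (p - q) \<bullet> u"
proof -
  have "extent u P \<in> {(p - q) \<bullet> u | p q. p \<in> P \<and> q \<in> P}"
    unfolding extent_def using assms by (intro Max_in finite_extents) auto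
  then show thesis using that by blast
qed

lemma extent_nonneg:
  assumes "finite P" "P \<noteq> {}"
  shows "0 \<le> extent u P"
proof -
  obtain p where "p \<in> P" using assms by blast
  then show ?thesis using extent_ge[of P p p u] assms by simp
qed

lemma extent_le:
  assumes "finite P" "P \<noteq> {}" "\<And>p q. p \<in> P \<Longrightarrow> q \<in> P \<Longrightarrow> (p - q) \<bullet> u \<le> c"
  shows "extent u P \<le> c"
proof -
  obtain p q where "p \<in> P" "q \<in> P" "extent u P = (p - q) \<bullet> u"
    using assms(1,2) by (rule extent_attained)
  then show ?thesis using assms(3) by simp
qed

lemma extent_le_diameter:
  assumes "finite P" "P \<noteq> {}" "norm u = 1"
  shows "extent u P \<le> diameter P"
proof (rule extent_le)
  fix p q assume "p \<in> P" "q \<in> P"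
  then have "dist p q \<le> diameter P"
    using assms by (simp add: diameter_bounded_bound finite_imp_bounded)
  moreover have "(p - q) \<bullet> u \<le> norm (p - q)"
    using norm_cauchy_schwarz[of "p - q" u] assms by simp
  ultimately show "(p - q) \<bullet> u \<le> diameter P" by (simp add: dist_norm)
qed (use assms in auto)

section \<open>Orientations as real angles\<close>

lift_definition orient :: "real \<Rightarrow> orientation" is dir by simp

lemma width_orient: "width (orient \<theta>) P = extent (dir \<theta>) P"
  by transfer (simp add: extent_def)

lemma perp_orient: "perp (orient \<theta>) = orient (\<theta> + pi / 2)"
  by transfer (simp add: dir_def cos_add sin_add vec_eq_iff forall_2 norm_eq_1 inner_vec_def sum_2
      power2_eq_square[symmetric])

lemma orient_cases:
  obtains \<theta> where "\<alpha> = orient \<theta>"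
proof -
  have "\<exists>\<theta>. \<alpha> = orient \<theta>"
    by transfer (simp, metis unit_eq_dir)
  then show thesis using that by blast
qed

lemma orientation_dist_orient: "orientation_dist (orient a) (orient b) = arccos \<bar>cos (a - b)\<bar>"
  by transfer (simp add: inner_dir)

lemma arccos_abs_cos_le: "arccos \<bar>cos x\<bar> \<le> \<bar>x\<bar>"
proof (cases "\<bar>x\<bar> \<le> pi / 2")
  case True
  then have "0 \<le> cos x" by (intro cos_ge_zero) auto
  then have "arccos \<bar>cos x\<bar> = arccos (cos \<bar>x\<bar>)" by simp
  also have "\<dots> = \<bar>x\<bar>" using True by (intro arccos_cos) (use pi_gt_zero in linarith)+
  finally show ?thesis by simp
next
  case False
  have "arccos \<bar>cos x\<bar> \<le> arccos 0" by (intro arccos_le_arccos) auto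
  then show ?thesis using False by simp
qed

text \<open>A Lipschitz real-valued lift of the angle thus gives a Lipschitz orientation: passing to
  the quotient can only shorten distances.\<close>

lemma orientation_dist_orient_le: "orientation_dist (orient a) (orient b) \<le> \<bar>a - b\<bar>"
  by (simp add: orientation_dist_orient arccos_abs_cos_le)

section \<open>Elementary estimates for \<open>arctan\<close> and \<open>sin\<close>\<close>

lemma abs_arctan_diff_le: "\<bar>arctan x - arctan y\<bar> \<le> \<bar>x - y\<bar>"
proof -
  have "norm (arctan x - arctan y) \<le> 1 * norm (x - y)"
  proof (rule field_differentiable_bound[of UNIV arctan "\<lambda>x. inverse (1 + x\<^sup>2)"])
    show "(arctan has_field_derivative inverse (1 + z\<^sup>2)) (at z within UNIV)" for z
      by (rule DERIV_arctan)
    show "norm (inverse (1 + z\<^sup>2)) \<le> 1" for z :: real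
      by (simp add: inverse_le_1_iff)
  qed auto
  then show ?thesis by simp
qed

text \<open>A weak form of Jordan's inequality. With \<open>y = x / 2\<close>, multiply
  \<open>y \<le> tan y\<close> by \<open>(cos y)\<^sup>2\<close>, which is at least
  \<open>1 / 2\<close> on \<open>0 \<le> y \<le> pi / 4\<close>.\<close>

lemma abs_le_two_abs_sin:
  fixes x :: real
  assumes "\<bar>x\<bar> \<le> pi / 2"
  shows "\<bar>x\<bar> \<le> 2 * \<bar>sin x\<bar>"
proof -
  have *: "x \<le> 2 * sin x" if "0 \<le> x" "x \<le> pi / 2" for x :: real
  proof -
    define y where "y = x / 2"
    have y: "0 \<le> y" "y \<le> pi / 4" using that by (auto simp: y_def)
    have "cos (pi / 4) \<le> cos y" by (rule cos_monotone_0_pi_le) (use y in auto)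
    then have c: "sqrt 2 / 2 \<le> cos y" by (simp add: cos_45)
    then have pos: "0 < cos y" by (rule less_le_trans[rotated]) simp
    have "(sqrt 2 / 2)\<^sup>2 \<le> (cos y)\<^sup>2" by (rule power_mono[OF c]) simp
    then have c2: "1 / 2 \<le> cos y * cos y" by (simp add: power_divide power2_eq_square)
    have "y \<le> tan y" using arctan_le_self[of "tan y"] y arctan_tan[of y] tan_gt_zero[of y]
      by (cases "y = 0") (auto intro: order.trans)
    then have "y * cos y \<le> sin y" using pos by (simp add: tan_def pos_le_divide_eq)
    then have "y * (cos y * cos y) \<le> sin y * cos y"
      using pos by (metis mult.assoc mult_right_mono less_imp_le)
    moreover have "y * (1 / 2) \<le> y * (cos y * cos y)" using c2 y(1) by (rule mult_left_mono)
    ultimately have "y / 2 \<le> sin y * cos y" by simp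
    moreover have "sin x = 2 * sin y * cos y" using sin_double[of y] by (simp add: y_def)
    ultimately show ?thesis by (simp add: y_def)
  qed
  show ?thesis
  proof (cases "0 \<le> x")
    case True
    then show ?thesis using *[of x] assms by linarith
  next
    case False
    then show ?thesis using *[of "- x"] assms by simp
  qed
qed

section \<open>Diagonals of bounding boxes\<close>

definition diametral :: "(real^2) set \<Rightarrow> real \<Rightarrow> bool" where
  "diametral P d \<longleftrightarrow> (\<exists>p\<in>P. \<exists>q\<in>P. p - q = diameter P *\<^sub>R dir d)"

text \<open>If \<open>P\<close> lies on a line at angle \<open>\<psi>\<close> in the quadrant between the axes \<open>d - pi / 4\<close> and
  \<open>d + pi / 4\<close>, then the extents along the axes are proportional to the cosine and the sine of \<open>\<psi> - (d - pi / 4)\<close>, so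
  that the diagonal recovers \<open>\<psi>\<close> exactly. The quotient below is the tangent of \<open>\<psi> - d\<close>.\<close>

definition diag :: "real \<Rightarrow> (real^2) set \<Rightarrow> real" where
  "diag d P = (let a = extent (dir (d - pi / 4)) P; b = extent (dir (d + pi / 4)) P
    in d + arctan ((b - a) / (a + b)))"

section \<open>Diametral directions\<close>

lemma diametral_exists:
  assumes "finite P" "P \<noteq> {}"
  obtains d where "diametral P d"
proof -
  obtain p q where pq: "p \<in> P" "q \<in> P" "dist p q = diameter P"
    using diameter_compact_attained[of P] assms finite_imp_compact by blast
  have "\<exists>d. p - q = diameter P *\<^sub>R dir d"
  \<comment> \<open>If \<open>p = q\<close>, the diameter is 0 and any direction serves.\<close>
  proof (cases "p = q")
    case False
    then have "norm ((p - q) /\<^sub>R norm (p - q)) = 1" by simp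
    then obtain d where "(p - q) /\<^sub>R norm (p - q) = dir d" by (rule unit_eq_dir)
    then have "norm (p - q) *\<^sub>R dir d = norm (p - q) *\<^sub>R ((p - q) /\<^sub>R norm (p - q))"
      by (simp only:)
    then have "p - q = norm (p - q) *\<^sub>R dir d" using False by simp
    then show ?thesis using pq(3) by (auto simp only: dist_norm)
  qed (use pq in auto)
  then obtain d where "p - q = diameter P *\<^sub>R dir d" ..
  with pq have "diametral P d" unfolding diametral_def by blast
  then show thesis by (rule that)
qed

lemma dir_add_int_pi: "dir (d + of_int m * pi) = dir d \<or> dir (d + of_int m * pi) = - dir d"
proof -
  have s: "sin (of_int m * pi) = 0" using sin_npi_int[of m] by (simp add: mult.commute)
  then have "(cos (of_int m * pi))\<^sup>2 = 1" using sin_cos_squared_add[of "of_int m * pi"] by simp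
  then have "cos (of_int m * pi) = 1 \<or> cos (of_int m * pi) = - 1" by (simp add: power2_eq_1_iff)
  then show ?thesis using s dir_add[of d "of_int m * pi"] by auto
qed

lemma diametral_add_int_pi:
  assumes "diametral P d"
  shows "diametral P (d + of_int m * pi)"
proof -
  obtain p q where pq: "p \<in> P" "q \<in> P" "p - q = diameter P *\<^sub>R dir d"
    using assms unfolding diametral_def by blast
  have "q - p = - (p - q)" by simp
  also have "\<dots> = diameter P *\<^sub>R (- dir d)" by (simp only: pq(3) scaleR_minus_right)
  finally have qp: "q - p = diameter P *\<^sub>R (- dir d)" .
  from dir_add_int_pi[of d m] show ?thesis
    unfolding diametral_def using pq qp by (elim disjE) auto
qed

text \<open>A shift by a multiple of \<open>pi\<close> changes the axes at most in sign, so the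
  extents and the arctangent stay the same. This freedom lets \<open>frame\<close> pick the nearest
  lift.\<close>

lemma diag_add_int_pi: "diag (d + of_int m * pi) P = diag d P + of_int m * pi"
proof -
  have "extent (dir (e + of_int m * pi)) P = extent (dir e) P" for e
    using dir_add_int_pi[of e m] by (auto simp: extent_minus)
  from this[of "d - pi / 4"] this[of "d + pi / 4"] show ?thesis
    by (simp add: diag_def Let_def algebra_simps)
qed

text \<open>The diametral pair alone already projects to this length. All lower bounds on extents in
  terms of the diameter come from here.\<close>

lemma extent_ge_diametral:
  assumes "finite P" "diametral P d"
  shows "diameter P * \<bar>cos (d - \<theta>)\<bar> \<le> extent (dir \<theta>) P"
proof -
  obtain p q where pq: "p \<in> P" "q \<in> P" "p - q = diameter P *\<^sub>R dir d"
    using assms unfolding diametral_def by blast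
  have "\<bar>(p - q) \<bullet> dir \<theta>\<bar> \<le> extent (dir \<theta>) P"
    using pq assms by (intro extent_ge)
  moreover have "0 \<le> diameter P" using assms finite_imp_bounded diameter_ge_0 by blast
  ultimately show ?thesis by (simp add: pq(3) inner_dir abs_mult)
qed

text \<open>\<open>t\<close> is the polar angle of \<open>(a, b)\<close>, because
  \<open>tan (t - pi / 4) = (b - a) / (a + b)\<close>. Measuring from \<open>pi / 4\<close> avoids a
  division by \<open>a\<close>, which may be 0.\<close>

lemma polar_arctan:
  fixes a b :: real
  assumes "0 < a + b"
  defines "t \<equiv> pi / 4 + arctan ((b - a) / (a + b))"
  shows "sqrt (a\<^sup>2 + b\<^sup>2) * cos t = a" "sqrt (a\<^sup>2 + b\<^sup>2) * sin t = b"
proof -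
  define x where "x = (b - a) / (a + b)"
  have "1 + x\<^sup>2 = ((a + b)\<^sup>2 + (b - a)\<^sup>2) / (a + b)\<^sup>2"
    using assms(1) by (simp add: x_def power_divide add_divide_distrib)
  also have "(a + b)\<^sup>2 + (b - a)\<^sup>2 = 2 * (a\<^sup>2 + b\<^sup>2)"
    by algebra
  finally have sq: "sqrt (1 + x\<^sup>2) = sqrt 2 * sqrt (a\<^sup>2 + b\<^sup>2) / (a + b)"
    using assms(1) by (simp only: real_sqrt_divide real_sqrt_mult real_sqrt_abs abs_of_pos)
  have pos: "0 < sqrt (a\<^sup>2 + b\<^sup>2)"
    using assms(1) by (auto simp: sum_power2_gt_zero_iff)
  have x: "x * (a + b) = b - a" using assms(1) by (simp add: x_def)
  have t: "t = pi / 4 + arctan x" by (simp add: t_def x_def)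
  have "cos t = (1 - x) * (sqrt 2 / 2) / sqrt (1 + x\<^sup>2)"
    unfolding t cos_add cos_45 sin_45 cos_arctan sin_arctan
    by (simp add: left_diff_distrib diff_divide_distrib)
  then have "sqrt (a\<^sup>2 + b\<^sup>2) * cos t = (1 - x) * (a + b) / 2"
    using assms(1) pos by (simp add: sq)
  also have "\<dots> = a" using x by (simp add: left_diff_distrib)
  finally show "sqrt (a\<^sup>2 + b\<^sup>2) * cos t = a" .
  have "sin t = (1 + x) * (sqrt 2 / 2) / sqrt (1 + x\<^sup>2)"
    unfolding t sin_add cos_45 sin_45 cos_arctan sin_arctan
    by (simp add: distrib_right add_divide_distrib)
  then have "sqrt (a\<^sup>2 + b\<^sup>2) * sin t = (1 + x) * (a + b) / 2"
    using assms(1) pos by (simp add: sq)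
  also have "\<dots> = b" using x by (simp add: distrib_right)
  finally show "sqrt (a\<^sup>2 + b\<^sup>2) * sin t = b" .
qed

text \<open>\<open>A * y - B * x\<close> is the cross product of the diagonal \<open>(A, B)\<close>
  with \<open>(x, y)\<close>. Both vectors deviate by at most \<open>w\<close> from the line spanned
  by \<open>(\<bar>s\<bar>, \<bar>c\<bar>)\<close>, and \<open>(x, y)\<close> is no longer than the
  diagonal.\<close>

lemma cross_bound:
  fixes A B c s x y w :: real
  assumes "c\<^sup>2 + s\<^sup>2 = 1" "c * s \<le> 0" "\<bar>x\<bar> \<le> A" "\<bar>y\<bar> \<le> B" "\<bar>c * x + s * y\<bar> \<le> w"
    "\<bar>\<bar>c\<bar> * A - \<bar>s\<bar> * B\<bar> \<le> w"
  shows "\<bar>A * y - B * x\<bar> \<le> 2 * w * sqrt (A\<^sup>2 + B\<^sup>2)"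
proof -
  define a b where "a = \<bar>s\<bar>" and "b = \<bar>c\<bar>"
  have ab: "a\<^sup>2 + b\<^sup>2 = 1" using assms(1) by (simp add: a_def b_def)
  have xy: "\<bar>a * y - b * x\<bar> \<le> w"
  \<comment> \<open>Since \<open>c * s \<le> 0\<close>, the vector \<open>(c, s)\<close> is
    \<open>(b, - a)\<close> or \<open>(- b, a)\<close>, a unit normal to
    \<open>(a, b)\<close>.\<close>
  proof (cases "0 \<le> c \<and> s \<le> 0")
    case True
    then have "a * y - b * x = - (c * x + s * y)" by (simp add: a_def b_def)
    then show ?thesis using assms(5) by (simp only: abs_minus_cancel)
  next
    case False
    then have "c \<le> 0 \<and> 0 \<le> s" using assms(2) by (auto simp: mult_le_0_iff)
    then have "a * y - b * x = c * x + s * y" by (simp add: a_def b_def)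
    then show ?thesis using assms(5) by simp
  qed
  have AB: "\<bar>a * B - b * A\<bar> \<le> w" using assms(6) by (simp add: a_def b_def abs_minus_commute)
  \<comment> \<open>Cauchy-Schwarz for the unit vector \<open>(a, b)\<close>, from Lagrange's
    identity.\<close>
  have cs: "\<bar>a * p + b * q\<bar> \<le> sqrt (p\<^sup>2 + q\<^sup>2)" for p q
  proof -
    have "(a * p + b * q)\<^sup>2 + (a * q - b * p)\<^sup>2 = (a\<^sup>2 + b\<^sup>2) * (p\<^sup>2 + q\<^sup>2)"
      by algebra
    then have "(a * p + b * q)\<^sup>2 \<le> p\<^sup>2 + q\<^sup>2"
      using zero_le_power2[of "a * q - b * p"] unfolding ab mult_1 by linarith
    then show ?thesis by (simp add: real_le_rsqrt)
  qed
  have sq: "sqrt (x\<^sup>2 + y\<^sup>2) \<le> sqrt (A\<^sup>2 + B\<^sup>2)"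
    using power_mono[OF assms(3), of 2] power_mono[OF assms(4), of 2] by simp
  have "A * y - B * x = (a\<^sup>2 + b\<^sup>2) * (A * y - B * x)" using ab by simp
  \<comment> \<open>The cross product computed in the orthonormal frame \<open>(a, b)\<close>,
    \<open>(- b, a)\<close>.\<close>
  also have "\<dots> = (a * A + b * B) * (a * y - b * x) - (a * B - b * A) * (a * x + b * y)"
    by algebra
  also have "\<bar>\<dots>\<bar> \<le> \<bar>a * A + b * B\<bar> * \<bar>a * y - b * x\<bar> + \<bar>a * B - b * A\<bar> * \<bar>a * x + b * y\<bar>"
    unfolding abs_mult[symmetric] by (rule abs_triangle_ineq4)
  also have "\<dots> \<le> sqrt (A\<^sup>2 + B\<^sup>2) * w + w * sqrt (A\<^sup>2 + B\<^sup>2)"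
    using cs[of A B] order.trans[OF cs[of x y] sq] xy AB by (intro add_mono mult_mono) auto
  finally show ?thesis by simp
qed

lemma sqrt2_ge: "7 / 5 \<le> sqrt (2::real)"
  by (rule real_le_rsqrt) (simp add: power2_eq_square)

text \<open>Both axes make an angle of \<open>pi / 4\<close> with the diametral pair of
  \<open>P\<close>, so each extent of \<open>P\<close> is at least \<open>7 / 10\<close>; passing to
  \<open>Q\<close> costs at most \<open>1 / 10\<close> per axis.\<close>

lemma diag_frame_extents:
  assumes "finite P"
    and close: "\<And>\<theta>. \<bar>extent (dir \<theta>) P - extent (dir \<theta>) Q\<bar> \<le> 1 / 10"
    and D: "1 \<le> diameter P" "diametral P d"
  shows "6 / 5 \<le> extent (dir (d - pi / 4)) Q + extent (dir (d + pi / 4)) Q"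
proof -
  have "7 / 10 \<le> extent (dir \<theta>) P" if "cos (d - \<theta>) = sqrt 2 / 2" for \<theta>
  proof -
    have "7 / 10 \<le> diameter P * (sqrt 2 / 2)"
      using sqrt2_ge mult_mono[OF D(1), of "7 / 10" "sqrt 2 / 2"] D(1) by simp
    then show ?thesis using extent_ge_diametral[OF assms(1) D(2), of \<theta>] that by simp
  qed
  from this[of "d - pi / 4"] this[of "d + pi / 4"] close[of "d - pi / 4"] close[of "d + pi / 4"]
  show ?thesis by (simp add: cos_45) argo
qed

text \<open>\<open>arctan\<close> is 1-Lipschitz, so it suffices to compare the two quotients, whose
  denominators \<open>m\<close> keeps away from 0.\<close>

lemma diag_lipschitz:
  assumes "0 < m" "m \<le> extent (dir (d - pi / 4)) P + extent (dir (d + pi / 4)) P"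
    "m \<le> extent (dir (d - pi / 4)) Q + extent (dir (d + pi / 4)) Q"
    and P: "finite P" "P \<noteq> {}"
    and close: "\<And>\<theta>. \<bar>extent (dir \<theta>) P - extent (dir \<theta>) Q\<bar> \<le> r"
  shows "\<bar>diag d P - diag d Q\<bar> \<le> 2 * r / m"
proof -
  define a b a' b' where "a = extent (dir (d - pi / 4)) P" and "b = extent (dir (d + pi / 4)) P"
    and "a' = extent (dir (d - pi / 4)) Q" and "b' = extent (dir (d + pi / 4)) Q"
  have c: "\<bar>a - a'\<bar> \<le> r" "\<bar>b - b'\<bar> \<le> r" "m \<le> a + b" "m \<le> a' + b'" "0 \<le> a" "0 \<le> b"
    using close assms P by (auto simp: a_def b_def a'_def b'_def extent_nonneg)
  have "\<bar>diag d P - diag d Q\<bar> \<le> \<bar>(b - a) / (a + b) - (b' - a') / (a' + b')\<bar>"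
    using abs_arctan_diff_le
    by (simp add: diag_def Let_def a_def b_def a'_def b'_def)
  also have "(b - a) / (a + b) - (b' - a') / (a' + b')
      = (((b - b') - (a - a')) - (b - a) / (a + b) * ((a - a') + (b - b'))) / (a' + b')"
  proof -
    define u where "u = (b - a) / (a + b)"
    have u: "b - a = u * (a + b)" using c \<open>0 < m\<close> by (simp add: u_def)
    have "((b - b') - (a - a')) - u * ((a - a') + (b - b')) = u * (a' + b') - (b' - a')"
      using u by (simp add: algebra_simps)
    moreover have "a' + b' \<noteq> 0" using c \<open>0 < m\<close> by linarith
    ultimately have "u - (b' - a') / (a' + b')
        = (((b - b') - (a - a')) - u * ((a - a') + (b - b'))) / (a' + b')"
      by (simp only: diff_divide_distrib[of "u * _"] nonzero_mult_div_cancel_right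
          not_False_eq_True)
    then show ?thesis unfolding u_def .
  qed
  also have "\<bar>\<dots>\<bar> \<le> 2 * r / (a' + b')"
  proof -
    have "\<bar>(b - a) / (a + b)\<bar> \<le> 1" using c \<open>0 < m\<close> by (simp add: abs_divide abs_le_iff)
    then have "\<bar>(b - a) / (a + b) * ((a - a') + (b - b'))\<bar> \<le> \<bar>(a - a') + (b - b')\<bar>"
      unfolding abs_mult by (rule mult_left_le_one_le[OF abs_ge_zero abs_ge_zero])
    \<comment> \<open>For changes \<open>x\<close> and \<open>y\<close> of the extents,
      \<open>\<bar>y - x\<bar> + \<bar>x + y\<bar>\<close> is twice the larger of
      \<open>\<bar>x\<bar>\<close> and \<open>\<bar>y\<bar>\<close>. This gives \<open>2 * r\<close>
      instead of \<open>4 * r\<close>.\<close>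
    then have "\<bar>((b - b') - (a - a')) - (b - a) / (a + b) * ((a - a') + (b - b'))\<bar> \<le> 2 * r"
      using c(1,2) by linarith
    then show ?thesis using c \<open>0 < m\<close> by (simp add: abs_divide divide_right_mono)
  qed
  also have "\<dots> \<le> 2 * r / m"
    using c \<open>0 < m\<close> by (intro divide_left_mono) auto
  finally show ?thesis .
qed

lemma abs_minus_le_of_abs_add_le:
  fixes x y :: real
  assumes "\<bar>y + x\<bar> \<le> w" "\<bar>x\<bar> \<le> b"
  shows "\<bar>y\<bar> - b \<le> w"
  using assms by linarith

text \<open>\<open>\<theta>\<close> is the direction of a strip, so its width is measured along the
  normal \<open>\<theta> + pi / 2\<close>.\<close>

definition near_thinnest :: "(real^2) set \<Rightarrow> real \<Rightarrow> bool" where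
  "near_thinnest P \<theta> \<longleftrightarrow> (\<forall>\<eta>. extent (dir (\<theta> + pi / 2)) P \<le> 2 * extent (dir \<eta>) P)"

text \<open>\<open>P\<close> is the set for which \<open>d\<close> was chosen, \<open>Q\<close> the
  set at a nearby time. A competing strip with normal \<open>dir \<eta>\<close> either runs through
  the same quadrant of the axes as the diagonal, and then \<open>cross_bound\<close> gives the
  factor 2, or it crosses the diametral pair at a large angle.\<close>

lemma diag_near_thinnest:
  assumes P: "finite P" "P \<noteq> {}"
    and Q: "finite Q" "Q \<noteq> {}"
    and close: "\<And>\<theta>. \<bar>extent (dir \<theta>) P - extent (dir \<theta>) Q\<bar> \<le> 1 / 10"
    and D: "1 \<le> diameter P" "diametral P d"
  shows "near_thinnest Q (diag d Q)"
  unfolding near_thinnest_def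
proof
  fix \<eta>
  define f A B where "f = d - pi / 4" and "A = extent (dir f) Q" and "B = extent (dir (f + pi / 2)) Q"
  define c s where "c = cos (\<eta> - f)" and "s = sin (\<eta> - f)"
  let ?w = "extent (dir \<eta>) Q" and ?\<psi> = "diag d Q"
  have cs: "c\<^sup>2 + s\<^sup>2 = 1" by (simp add: c_def s_def)
  have expand: "v \<bullet> dir \<eta> = c * (v \<bullet> dir f) + s * (v \<bullet> dir (f + pi / 2))" for v
    using dir_add[of f "\<eta> - f"] by (simp add: c_def s_def inner_add_right)
  have A: "\<bar>(p - q) \<bullet> dir f\<bar> \<le> A" and B: "\<bar>(p - q) \<bullet> dir (f + pi / 2)\<bar> \<le> B"
    and w: "\<bar>c * ((p - q) \<bullet> dir f) + s * ((p - q) \<bullet> dir (f + pi / 2))\<bar> \<le> ?w"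
    if "p \<in> Q" "q \<in> Q" for p q
    unfolding A_def B_def expand[symmetric] using Q that by (auto intro!: extent_ge)
  show "extent (dir (?\<psi> + pi / 2)) Q \<le> 2 * ?w"
  proof (cases "c * s \<le> 0")
    case True
    \<comment> \<open>For a pair attaining \<open>A\<close>, the other coordinate can cancel at most
      \<open>\<bar>s\<bar> * B\<close> of the projection \<open>\<bar>c\<bar> * A\<close> onto
      \<open>dir \<eta>\<close>.\<close>
    have "\<bar>c\<bar> * A - \<bar>s\<bar> * B \<le> ?w"
    proof -
      obtain p q where pq: "p \<in> Q" "q \<in> Q" "A = (p - q) \<bullet> dir f"
        using Q unfolding A_def by (rule extent_attained)
      have "\<bar>s * ((p - q) \<bullet> dir (f + pi / 2))\<bar> \<le> \<bar>s\<bar> * B"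
        unfolding abs_mult using B pq by (intro mult_left_mono) auto
      moreover have "\<bar>c * A + s * ((p - q) \<bullet> dir (f + pi / 2))\<bar> \<le> ?w"
        using w[OF pq(1,2)] by (simp only: pq(3))
      ultimately have "\<bar>c * A\<bar> - \<bar>s\<bar> * B \<le> ?w"
        by (rule abs_minus_le_of_abs_add_le[rotated])
      moreover have "\<bar>c * A\<bar> = \<bar>c\<bar> * A" using A[OF pq(1,2)] by (simp add: abs_mult)
      ultimately show ?thesis by (simp only:)
    qed
    moreover have "\<bar>s\<bar> * B - \<bar>c\<bar> * A \<le> ?w"
    proof -
      obtain p q where pq: "p \<in> Q" "q \<in> Q" "B = (p - q) \<bullet> dir (f + pi / 2)"
        using Q unfolding B_def by (rule extent_attained)
      have "\<bar>c * ((p - q) \<bullet> dir f)\<bar> \<le> \<bar>c\<bar> * A"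
        unfolding abs_mult using A pq by (intro mult_left_mono) auto
      moreover have "\<bar>s * B + c * ((p - q) \<bullet> dir f)\<bar> \<le> ?w"
        using w[OF pq(1,2)] by (simp only: pq(3) add.commute)
      ultimately have "\<bar>s * B\<bar> - \<bar>c\<bar> * A \<le> ?w"
        by (rule abs_minus_le_of_abs_add_le[rotated])
      moreover have "\<bar>s * B\<bar> = \<bar>s\<bar> * B" using B[OF pq(1,2)] by (simp add: abs_mult)
      ultimately show ?thesis by (simp only:)
    qed
    ultimately have AB: "\<bar>\<bar>c\<bar> * A - \<bar>s\<bar> * B\<bar> \<le> ?w"
      by (intro abs_leI) simp_all
    have "A + B > 0"
      using diag_frame_extents[OF P(1) close D] by (simp add: A_def B_def f_def add.commute)
    define R where "R = sqrt (A\<^sup>2 + B\<^sup>2)"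
    have R: "0 < R" unfolding R_def
      using \<open>A + B > 0\<close> by (auto simp: sum_power2_gt_zero_iff)
    have \<psi>: "?\<psi> = f + (pi / 4 + arctan ((B - A) / (A + B)))"
    proof -
      have "f + pi / 2 = d + pi / 4" by (simp add: f_def)
      then show ?thesis by (simp add: diag_def Let_def A_def B_def) (simp add: f_def)
    qed
    have polar: "R * cos (?\<psi> - f) = A" "R * sin (?\<psi> - f) = B"
      using polar_arctan[OF \<open>A + B > 0\<close>] by (simp_all add: R_def \<psi>)
    show ?thesis
    proof (rule extent_le[OF Q])
      fix p q assume pq: "p \<in> Q" "q \<in> Q"
      let ?x = "(p - q) \<bullet> dir f" and ?y = "(p - q) \<bullet> dir (f + pi / 2)"
      have "dir (?\<psi> + pi / 2) = cos (?\<psi> - f) *\<^sub>R dir (f + pi / 2) - sin (?\<psi> - f) *\<^sub>R dir f"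
        using dir_add[of "f + pi / 2" "?\<psi> - f"] dir_add_pi[of f] by (simp add: algebra_simps)
      then have "R * ((p - q) \<bullet> dir (?\<psi> + pi / 2)) = (R * cos (?\<psi> - f)) * ?y - (R * sin (?\<psi> - f)) * ?x"
        by (simp add: inner_diff_right right_diff_distrib mult.assoc)
      also have "\<dots> = A * ?y - B * ?x" by (simp only: polar)
      also have "\<dots> \<le> 2 * ?w * R"
        using cross_bound[OF cs True A[OF pq] B[OF pq] w[OF pq] AB] by (simp add: R_def)
      finally show "(p - q) \<bullet> dir (?\<psi> + pi / 2) \<le> 2 * ?w" using R by (simp add: mult.commute)
    qed
  next
    \<comment> \<open>The diametral pair is then far from parallel to the strip with normal \<open>dir \<eta>\<close>, which is wide.\<close>
    case False
    have "diameter P * \<bar>cos (d - \<eta>)\<bar> \<le> extent (dir \<eta>) P"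
      using P D by (intro extent_ge_diametral)
    moreover have "7 / 10 \<le> \<bar>cos (d - \<eta>)\<bar>"
    proof -
      have "d - \<eta> = pi / 4 - (\<eta> - f)" by (simp add: f_def)
      then have "cos (d - \<eta>) = cos (pi / 4 - (\<eta> - f))" by (simp only:)
      also have "\<dots> = (sqrt 2 / 2) * (c + s)"
        unfolding cos_diff[of "pi / 4"] by (simp add: c_def s_def cos_45 sin_45 distrib_left)
      finally have cos: "\<bar>cos (d - \<eta>)\<bar> = (sqrt 2 / 2) * \<bar>c + s\<bar>"
        by (simp only: abs_mult) simp
      have "1 \<le> \<bar>c + s\<bar>"
      proof -
        have "(c + s)\<^sup>2 = (c\<^sup>2 + s\<^sup>2) + 2 * (c * s)" by (simp add: power2_sum)
        then have "1 \<le> (c + s)\<^sup>2" using cs False by simp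
        then show ?thesis by (simp add: abs_le_square_iff[of 1, simplified])
      qed
      then have "sqrt 2 / 2 * 1 \<le> sqrt 2 / 2 * \<bar>c + s\<bar>" by (rule mult_left_mono) simp
      moreover have "7 / 10 \<le> sqrt 2 / 2 * 1" using sqrt2_ge by simp
      ultimately show ?thesis unfolding cos by (rule order.trans[rotated])
    qed
    then have "diameter P * (7 / 10) \<le> diameter P * \<bar>cos (d - \<eta>)\<bar>"
      using D(1) by (intro mult_left_mono) auto
    ultimately have "7 / 10 * diameter P \<le> extent (dir \<eta>) P" by simp
    moreover have "extent (dir (?\<psi> + pi / 2)) P \<le> diameter P"
      using P by (simp add: extent_le_diameter)
    \<comment> \<open>With \<open>D\<close> the diameter of \<open>P\<close>, the numbers fit
      because \<open>D + 1 / 10 \<le> 2 * (7 / 10 * D - 1 / 10)\<close> for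
      \<open>D \<ge> 1\<close>.\<close>
    ultimately show ?thesis using close[of \<eta>] close[of "?\<psi> + pi / 2"] D(1)
      unfolding abs_le_iff by linarith
  qed
qed

section \<open>The chasing algorithm\<close>

text \<open>Angles of diametral pairs are only determined modulo \<open>pi\<close>; choosing the one whose diagonal is
  nearest to the current angle makes the output a real-valued lift.\<close>

definition frame :: "(real^2) set \<Rightarrow> real \<Rightarrow> real" where
  "frame P a = (SOME d. diametral P d \<and> \<bar>a - diag d P\<bar> \<le> pi / 2)"

text \<open>Rounding the gap between \<open>a\<close> and some diagonal to the nearest multiple of
  \<open>pi\<close> leaves at most half a period.\<close>

lemma frame:
  assumes "finite P" "P \<noteq> {}"
  shows "diametral P (frame P a)" "\<bar>a - diag (frame P a) P\<bar> \<le> pi / 2"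
proof -
  obtain d where d: "diametral P d" using assms by (rule diametral_exists)
  define x where "x = (a - diag d P) / pi"
  have "\<bar>x - of_int (round x)\<bar> \<le> 1 / 2"
    using of_int_round_abs_le[of x] by (simp add: abs_minus_commute)
  then have "\<bar>x - of_int (round x)\<bar> * pi \<le> 1 / 2 * pi" by (rule mult_right_mono) simp
  moreover have "\<bar>x - of_int (round x)\<bar> * pi = \<bar>(x - of_int (round x)) * pi\<bar>"
    by (simp add: abs_mult)
  moreover have "(x - of_int (round x)) * pi = a - diag (d + of_int (round x) * pi) P"
    by (simp add: diag_add_int_pi left_diff_distrib) (simp add: x_def)
  ultimately have "\<bar>a - diag (d + of_int (round x) * pi) P\<bar> \<le> pi / 2" by simp
  then have "\<exists>d. diametral P d \<and> \<bar>a - diag d P\<bar> \<le> pi / 2"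
    using diametral_add_int_pi[OF d] by blast
  from someI_ex[OF this]
  show "diametral P (frame P a)" "\<bar>a - diag (frame P a) P\<bar> \<le> pi / 2"
    unfolding frame_def by auto
qed

text \<open>Soft thresholding: for \<open>r \<ge> 0\<close>, \<open>x\<close> moves towards 0 by
  \<open>r\<close> and stops there.\<close>

definition shrink :: "real \<Rightarrow> real \<Rightarrow> real" where
  "shrink r x = x - max (- r) (min r x)"

lemma shrink_lipschitz: "0 \<le> r \<Longrightarrow> 0 \<le> r' \<Longrightarrow> \<bar>shrink r x - shrink r' x\<bar> \<le> \<bar>r - r'\<bar>"
  unfolding shrink_def by linarith

lemma abs_shrink_le: "0 \<le> r \<Longrightarrow> \<bar>shrink r x\<bar> \<le> max 0 (\<bar>x\<bar> - r)"
  unfolding shrink_def by linarith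

text \<open>\<open>s\<close> is the time at which the frame is chosen and \<open>a\<close> the angle
  held then. Only \<open>P s\<close> and \<open>P t\<close> are read, which keeps the algorithm
  state-aware.\<close>

definition follow :: "(real \<Rightarrow> (real^2) set) \<Rightarrow> real \<Rightarrow> real \<Rightarrow> real \<Rightarrow> real" where
  "follow P s a t = (let d = frame (P s) a
    in diag d (P t) + shrink (32 * (t - s)) (a - diag d (P s)))"

lemma follow_start: "follow P s a s = a"
  by (simp add: follow_def Let_def shrink_def)

text \<open>Angles at the grid times \<open>k / 20\<close>. The first lies on a diagonal, so that it
  is near-thinnest from the start; the reference angle 0 is arbitrary.\<close>

primrec node :: "(real \<Rightarrow> (real^2) set) \<Rightarrow> nat \<Rightarrow> real" where
  "node P 0 = diag (frame (P 0) 0) (P 0)"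
| "node P (Suc k) = follow P (real k / 20) (node P k) (real (Suc k) / 20)"

definition angle :: "(real \<Rightarrow> (real^2) set) \<Rightarrow> real \<Rightarrow> real" where
  "angle P t = (let k = nat \<lfloor>20 * t\<rfloor> in follow P (real k / 20) (node P k) t)"

text \<open>At the right end of a step the floor already selects step \<open>k + 1\<close>, which by
  \<open>follow_start\<close> begins at the value where step \<open>k\<close> ends.\<close>

lemma angle_eq_follow:
  assumes "real k / 20 \<le> t" "t \<le> real (Suc k) / 20"
  shows "angle P t = follow P (real k / 20) (node P k) t"
proof (cases "t = real (Suc k) / 20")
  case True
  then have "20 * t = of_nat (Suc k)" by simp
  then have "nat \<lfloor>20 * t\<rfloor> = Suc k" by (simp only: floor_of_nat nat_int)
  then have "angle P t = follow P t (node P (Suc k)) t"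
    by (simp only: angle_def Let_def True)
  then show ?thesis by (simp only: follow_start node.simps True)
next
  case False
  then have "\<lfloor>20 * t\<rfloor> = int k" using assms by (intro floor_unique) auto
  then show ?thesis by (simp add: angle_def)
qed

text \<open>For \<open>t < 0\<close> the interval \<open>{0..t}\<close> is empty, so a state-aware
  output must not depend on the input.\<close>

definition chaser :: algorithm where
  "chaser P t = (if t < 0 then orient 0 else orient (angle P t))"

text \<open>The output at time \<open>t\<close> reads the input only at \<open>t\<close> and at grid
  times up to \<open>t\<close>.\<close>

lemma state_aware_chaser: "state_aware chaser"
  unfolding state_aware_def
proof (intro allI impI)
  fix P Q :: "real \<Rightarrow> (real^2) set" and t :: real
  assume eq: "\<forall>s\<in>{0..t}. P s = Q s"
  have follow_cong: "follow P s a r = follow Q s a r" if "P s = Q s" "P r = Q r" for s a r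
    using that by (simp add: follow_def)
  have node_eq: "node P k = node Q k" if "real k / 20 \<le> t" for k
    using that
  proof (induction k)
    case 0
    then show ?case using eq by simp
  next
    case (Suc k)
    then have k: "real k / 20 \<le> t" by simp
    have "P (real k / 20) = Q (real k / 20)" "P (real (Suc k) / 20) = Q (real (Suc k) / 20)"
      using eq Suc.prems k by auto
    then show ?case using Suc.IH[OF k] follow_cong by (simp del: of_nat_Suc)
  qed
  show "chaser P t = chaser Q t"
  proof (cases "t < 0")
    case False
    define k where "k = nat \<lfloor>20 * t\<rfloor>"
    have k: "real k / 20 \<le> t" using False by (simp add: k_def) linarith
    then have "P (real k / 20) = Q (real k / 20)" "P t = Q t" using eq False by auto
    then show ?thesis
      using node_eq[OF k] follow_cong False by (simp add: chaser_def angle_def Let_def flip: k_def)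
  qed (simp add: chaser_def)
qed

text \<open>Expand \<open>dir (\<theta> + x)\<close> in the frame at \<open>\<theta>\<close>. This
  converts an angular offset from the diagonal into extra strip width.\<close>

lemma extent_rotate:
  assumes "finite P" "P \<noteq> {}"
  shows "extent (dir (\<theta> + x)) P \<le> extent (dir \<theta>) P + \<bar>x\<bar> * extent (dir (\<theta> + pi / 2)) P"
proof (rule extent_le[OF assms])
  fix p q assume pq: "p \<in> P" "q \<in> P"
  let ?a = "(p - q) \<bullet> dir \<theta>" and ?b = "(p - q) \<bullet> dir (\<theta> + pi / 2)"
  have "(p - q) \<bullet> dir (\<theta> + x) = cos x * ?a + sin x * ?b"
    by (simp add: dir_add[of \<theta> x] inner_add_right)
  also have "\<dots> \<le> \<bar>cos x\<bar> * \<bar>?a\<bar> + \<bar>sin x\<bar> * \<bar>?b\<bar>"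
    unfolding abs_mult[symmetric] by linarith
  also have "\<dots> \<le> 1 * extent (dir \<theta>) P + \<bar>x\<bar> * extent (dir (\<theta> + pi / 2)) P"
    using extent_ge[OF assms(1) pq] by (intro add_mono mult_mono) (auto simp: abs_sin_x_le_abs_x)
  finally show "(p - q) \<bullet> dir (\<theta> + x)
      \<le> extent (dir \<theta>) P + \<bar>x\<bar> * extent (dir (\<theta> + pi / 2)) P" by simp
qed

section \<open>Analysis of the chasing algorithm\<close>

locale motion =
  fixes T :: real and n :: nat and p :: "nat \<Rightarrow> real \<Rightarrow> real^2"
  assumes admissible: "admissible_motion T n p"
begin

abbreviation "P \<equiv> points_at n p"

section \<open>Speed bounds for extents\<close>

lemma finite_points: "finite (P t)"
  by (simp add: points_at_def)

lemma diameter_ge_1: "t \<in> {0..T} \<Longrightarrow> 1 \<le> diameter (P t)"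
  using admissible by (simp add: admissible_motion_def)

lemma points_nonempty: "t \<in> {0..T} \<Longrightarrow> P t \<noteq> {}"
  using diameter_ge_1[of t] by (auto simp del: atLeastAtMost_iff)

text \<open>The factor 2 arises because both points of an extremal pair may move at unit
  speed.\<close>

lemma extent_le_extent:
  assumes "s \<in> {0..T}" "t \<in> {0..T}"
  shows "extent (dir \<theta>) (P s) \<le> extent (dir \<theta>) (P t) + 2 * \<bar>s - t\<bar>"
proof (rule extent_le[OF finite_points points_nonempty[OF assms(1)]])
  fix x y assume "x \<in> P s" "y \<in> P s"
  then obtain i j where ij: "i < n" "j < n" "x = p i s" "y = p j s"
    unfolding points_at_def by auto
  have move: "\<bar>(p i s - p i t) \<bullet> dir \<theta>\<bar> \<le> \<bar>s - t\<bar>" if "i < n" for i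
  proof -
    have "dist (p i s) (p i t) \<le> 1 * dist s t"
      using admissible that assms unfolding admissible_motion_def by (intro lipschitz_onD) auto
    moreover have "\<bar>(p i s - p i t) \<bullet> dir \<theta>\<bar> \<le> norm (p i s - p i t) * norm (dir \<theta>)"
      by (rule Cauchy_Schwarz_ineq2)
    ultimately show ?thesis by (simp add: dist_norm)
  qed
  have "\<bar>(p i t - p j t) \<bullet> dir \<theta>\<bar> \<le> extent (dir \<theta>) (P t)"
    using ij by (intro extent_ge finite_points) (auto simp: points_at_def)
  moreover define r where "r = \<bar>s - t\<bar>"
  ultimately show "(x - y) \<bullet> dir \<theta> \<le> extent (dir \<theta>) (P t) + 2 * \<bar>s - t\<bar>"
    using move[OF ij(1)] move[OF ij(2)] unfolding ij inner_diff_left abs_le_iff r_def[symmetric]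
    by linarith
qed

lemma extent_close:
  assumes "s \<in> {0..T}" "t \<in> {0..T}"
  shows "\<bar>extent (dir \<theta>) (P s) - extent (dir \<theta>) (P t)\<bar> \<le> 2 * \<bar>s - t\<bar>"
  using extent_le_extent[OF assms, of \<theta>] extent_le_extent[OF assms(2,1), of \<theta>]
  by (simp add: abs_le_iff abs_minus_commute[of t s])

lemma extent_close_step:
  assumes "s \<in> {0..T}" "t \<in> {0..T}" "\<bar>s - t\<bar> \<le> 1 / 20"
  shows "\<bar>extent (dir \<theta>) (P s) - extent (dir \<theta>) (P t)\<bar> \<le> 1 / 10"
  by (rule order.trans[OF extent_close[OF assms(1,2)]]) (use assms(3) in simp)

lemma diag_near_thinnest_step:
  assumes "s \<in> {0..T}" "t \<in> {0..T}" "\<bar>s - t\<bar> \<le> 1 / 20" "diametral (P s) d"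
  shows "near_thinnest (P t) (diag d (P t))"
  using diag_near_thinnest[OF finite_points points_nonempty[OF assms(1)]
      finite_points points_nonempty[OF assms(2)] extent_close_step[OF assms(1,2,3)]
      diameter_ge_1[OF assms(1)] assms(4)] .

section \<open>One step of the algorithm\<close>

lemma follow_lipschitz:
  assumes "0 \<le> s" "s \<le> t" "s \<le> t'" "t \<le> s + 1 / 20" "t' \<le> s + 1 / 20" "t \<le> T" "t' \<le> T"
  shows "\<bar>follow P s a t - follow P s a t'\<bar> \<le> 43 * \<bar>t - t'\<bar>"
proof -
  have in_T: "s \<in> {0..T}" "t \<in> {0..T}" "t' \<in> {0..T}" using assms by auto
  define d where "d = frame (P s) a"
  have d: "diametral (P s) d"
    using frame[OF finite_points points_nonempty] in_T by (simp add: d_def)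
  have m: "6 / 5 \<le> extent (dir (d - pi / 4)) (P r) + extent (dir (d + pi / 4)) (P r)"
    if "r \<in> {0..T}" "\<bar>s - r\<bar> \<le> 1 / 20" for r
    using diag_frame_extents[OF finite_points extent_close_step[OF in_T(1) that]
        diameter_ge_1[OF in_T(1)] d] .
  let ?x = "a - diag d (P s)"
  have "\<bar>follow P s a t - follow P s a t'\<bar> \<le> \<bar>diag d (P t) - diag d (P t')\<bar>
      + \<bar>shrink (32 * (t - s)) ?x - shrink (32 * (t' - s)) ?x\<bar>"
    unfolding follow_def Let_def d_def[symmetric] add_diff_add by (rule abs_triangle_ineq)
  \<comment> \<open>Extents have speed at most 2 and their sum stays at least \<open>6 / 5\<close>,
    so the diagonal has speed at most \<open>10 / 3\<close>. With 32 for the offset the total stays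
    below 43.\<close>
  also have "\<dots> \<le> 2 * (2 * \<bar>t - t'\<bar>) / (6 / 5) + \<bar>32 * (t - s) - 32 * (t' - s)\<bar>"
    using assms in_T
    by (intro add_mono shrink_lipschitz diag_lipschitz m finite_points points_nonempty
        extent_close) auto
  also have "\<bar>32 * (t - s) - 32 * (t' - s)\<bar> = 32 * \<bar>t - t'\<bar>"
    by (simp add: abs_if)
  also have "2 * (2 * \<bar>t - t'\<bar>) / (6 / 5) + 32 * \<bar>t - t'\<bar> \<le> 43 * \<bar>t - t'\<bar>"
    using abs_ge_zero[of "t - t'"] by (simp del: abs_ge_zero)
  finally show ?thesis .
qed

lemma follow_end:
  assumes "0 \<le> s" "s + 1 / 20 \<le> T"
  shows "near_thinnest (P (s + 1 / 20)) (follow P s a (s + 1 / 20))"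
proof -
  have in_T: "s \<in> {0..T}" "s + 1 / 20 \<in> {0..T}" using assms by auto
  define d where "d = frame (P s) a"
  have d: "diametral (P s) d" "\<bar>a - diag d (P s)\<bar> \<le> pi / 2"
    using frame[OF finite_points points_nonempty] in_T by (simp_all add: d_def)
  \<comment> \<open>The rate 32 removes \<open>8 / 5\<close> within one step, so that even the
    largest offset is gone at its end.\<close>
  have "pi / 2 \<le> 32 * (1 / 20)" using pi_approx(2) by simp
  then have "shrink (32 * (1 / 20)) (a - diag d (P s)) = 0"
    using abs_shrink_le[of "32 * (1 / 20)" "a - diag d (P s)"] d(2) by simp
  then have "follow P s a (s + 1 / 20) = diag d (P (s + 1 / 20))"
    by (simp add: follow_def d_def Let_def)
  then show ?thesis using diag_near_thinnest_step[OF in_T _ d(1)] by simp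
qed

text \<open>The diametral pair is nearly parallel to every near-thinnest strip, which bounds the
  initial offset by the width of any competitor. The decay then outpaces the decrease of that
  width.\<close>

lemma follow_thin:
  assumes a: "near_thinnest (P s) a"
    and "0 \<le> s" "s \<le> t" "t \<le> s + 1 / 20" "t \<le> T"
  shows "extent (dir (follow P s a t + pi / 2)) (P t) \<le> 12 * extent (dir \<eta>) (P t)"
proof -
  have in_T: "s \<in> {0..T}" "t \<in> {0..T}" and st: "\<bar>s - t\<bar> \<le> 1 / 20" using assms by auto
  define d \<psi> h where "d = frame (P s) a" and "\<psi> = diag d (P t)" and "h = t - s"
  define \<delta> where "\<delta> = a - diag d (P s)"
  let ?D = "diameter (P s)" and ?v = "extent (dir \<eta>) (P s)" and ?w = "extent (dir \<eta>) (P t)"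
  have d: "diametral (P s) d" "\<bar>\<delta>\<bar> \<le> pi / 2"
    using frame[OF finite_points points_nonempty] in_T by (simp_all add: d_def \<delta>_def)
  have D: "1 \<le> ?D" using diameter_ge_1 in_T by simp
  have h: "0 \<le> h" using assms by (simp add: h_def)
  \<comment> \<open>Project the diametral pair onto the normal of the strip with direction
    \<open>b\<close>.\<close>
  have sin_le: "?D * \<bar>sin (d - b)\<bar> \<le> 2 * ?v" if "near_thinnest (P s) b" for b
  proof -
    have "cos (d - (b + pi / 2)) = sin (d - b)"
      using cos_sin_eq[of "d - (b + pi / 2)"] by (simp add: cos_diff cos_add sin_add sin_diff)
    then have "?D * \<bar>sin (d - b)\<bar> \<le> extent (dir (b + pi / 2)) (P s)"
      using extent_ge_diametral[OF finite_points d(1), of "b + pi / 2"] by simp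
    then show ?thesis using that unfolding near_thinnest_def by (meson order.trans)
  qed
  have "near_thinnest (P s) (diag d (P s))"
    using diag_near_thinnest_step[OF in_T(1) in_T(1) _ d(1)] by simp
  have "\<bar>sin \<delta>\<bar> \<le> \<bar>sin (d - a)\<bar> + \<bar>sin (d - diag d (P s))\<bar>"
  proof -
    have "\<delta> = (d - diag d (P s)) - (d - a)" by (simp add: \<delta>_def)
    then have "\<bar>sin \<delta>\<bar> \<le> \<bar>sin (d - diag d (P s)) * cos (d - a)\<bar> + \<bar>cos (d - diag d (P s)) * sin (d - a)\<bar>"
      by (simp only: sin_diff abs_triangle_ineq4)
    also have "\<dots> \<le> \<bar>sin (d - diag d (P s))\<bar> + \<bar>sin (d - a)\<bar>"
      by (intro add_mono) (simp_all add: abs_mult mult_left_le mult_left_le_one_le)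
    finally show ?thesis by simp
  qed
  then have "?D * \<bar>sin \<delta>\<bar> \<le> ?D * (\<bar>sin (d - a)\<bar> + \<bar>sin (d - diag d (P s))\<bar>)"
    using D by (intro mult_left_mono) auto
  then have "?D * \<bar>sin \<delta>\<bar> \<le> 4 * ?v"
    using sin_le[OF a] sin_le[OF \<open>near_thinnest (P s) (diag d (P s))\<close>]
    by (simp add: distrib_left)
  \<comment> \<open>\<open>frame\<close> keeps \<open>\<delta>\<close> within \<open>pi / 2\<close>,
    where its sine controls it.\<close>
  moreover have "?D * \<bar>\<delta>\<bar> \<le> ?D * (2 * \<bar>sin \<delta>\<bar>)"
    using D abs_le_two_abs_sin[OF d(2)] by (intro mult_left_mono) auto
  ultimately have \<delta>: "?D * \<bar>\<delta>\<bar> \<le> 8 * ?v" by simp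
  define x where "x = shrink (32 * h) \<delta>"
  have x: "\<bar>x\<bar> \<le> max 0 (\<bar>\<delta>\<bar> - 32 * h)"
    unfolding x_def using h by (intro abs_shrink_le) simp
  have w: "0 \<le> ?w" using extent_nonneg finite_points points_nonempty in_T by simp
  have vw: "?v \<le> ?w + 2 * h"
    using extent_le_extent[OF in_T, of \<eta>] h by (simp add: h_def)
  have *: "\<bar>x\<bar> * (11 / 10 * ?D) \<le> 10 * ?w"
  proof (cases "\<bar>\<delta>\<bar> \<le> 32 * h")
    case True
    then show ?thesis using x w by simp
  next
    case False
    then have "\<bar>x\<bar> \<le> \<bar>\<delta>\<bar> - 32 * h" using x by simp
    then have "\<bar>x\<bar> * ?D \<le> (\<bar>\<delta>\<bar> - 32 * h) * ?D" using D by (intro mult_right_mono) auto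
    also have "\<dots> = ?D * \<bar>\<delta>\<bar> - 32 * h * ?D" by (simp add: algebra_simps)
    also have "\<dots> \<le> 8 * ?v - 32 * h * 1" using \<delta> D h by (intro diff_mono mult_left_mono) auto
    finally have "\<bar>x\<bar> * ?D \<le> 8 * ?v - 32 * h" by simp
    \<comment> \<open>\<open>8 * ?v \<le> 8 * ?w + 16 * h\<close>, and the decay
      \<open>32 * h\<close> absorbs \<open>16 * h\<close>. The factor \<open>11 / 10\<close> then
      turns 8 into less than 10.\<close>
    then show ?thesis using vw w h by linarith
  qed
  have "extent (dir \<psi>) (P t) \<le> ?D + 1 / 10"
    using extent_close_step[OF in_T st, of \<psi>]
      extent_le_diameter[OF finite_points points_nonempty[OF in_T(1)] norm_dir[of \<psi>]]
    unfolding abs_le_iff by linarith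
  then have "\<bar>x\<bar> * extent (dir \<psi>) (P t) \<le> \<bar>x\<bar> * (11 / 10 * ?D)"
    using D by (intro mult_left_mono) auto
  then have "\<bar>x\<bar> * extent (dir \<psi>) (P t) \<le> 10 * ?w" using * by linarith
  moreover have "extent (dir (\<psi> + pi / 2)) (P t) \<le> 2 * ?w"
    using diag_near_thinnest_step[OF in_T st d(1)] by (simp add: near_thinnest_def \<psi>_def)
  \<comment> \<open>The normal to \<open>\<psi> + pi / 2\<close> is \<open>\<psi> + pi\<close>,
    which has the same extent as \<open>\<psi>\<close>. The bounds 2 and 10 add up to 12.\<close>
  moreover have "extent (dir (\<psi> + pi / 2 + x)) (P t)
      \<le> extent (dir (\<psi> + pi / 2)) (P t) + \<bar>x\<bar> * extent (dir \<psi>) (P t)"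
    using extent_rotate[OF finite_points points_nonempty[OF in_T(2)], of "\<psi> + pi / 2" x]
      dir_add_pi[of \<psi>] by (simp add: extent_minus add.assoc)
  moreover have "follow P s a t + pi / 2 = \<psi> + pi / 2 + x"
    by (simp add: follow_def Let_def \<psi>_def x_def h_def \<delta>_def d_def)
  ultimately show ?thesis by (simp only:)
qed

section \<open>From single steps to the whole time interval\<close>

lemma node_near_thinnest:
  assumes "real k / 20 \<le> T"
  shows "near_thinnest (P (real k / 20)) (node P k)"
  using assms
proof (induction k)
  case 0
  then have "0 \<in> {0..T}" by simp
  then show ?case
    using diag_near_thinnest_step[of 0 0] frame(1)[OF finite_points points_nonempty] by simp
next
  case (Suc k)
  have eq: "real (Suc k) / 20 = real k / 20 + 1 / 20" by (simp add: field_simps)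
  show ?case
    \<comment> \<open>A full step ends with offset 0, whatever the angle at its start.\<close>
    unfolding node.simps eq using Suc.prems unfolding eq by (intro follow_end) auto
qed

lemma grid_step_exists:
  fixes t :: real
  assumes "0 \<le> t"
  obtains k :: nat where "real k / 20 \<le> t" "t \<le> real (Suc k) / 20" "t \<le> real k / 20 + 1 / 20"
proof
  show "real (nat \<lfloor>20 * t\<rfloor>) / 20 \<le> t" "t \<le> real (Suc (nat \<lfloor>20 * t\<rfloor>)) / 20"
    "t \<le> real (nat \<lfloor>20 * t\<rfloor>) / 20 + 1 / 20"
    using assms by (simp; linarith)+
qed

lemma angle_thin:
  assumes "t \<in> {0..T}"
  shows "extent (dir (angle P t + pi / 2)) (P t) \<le> 12 * extent (dir \<eta>) (P t)"
proof -
  obtain k where k: "real k / 20 \<le> t" "t \<le> real (Suc k) / 20" "t \<le> real k / 20 + 1 / 20"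
    using assms by (auto intro: grid_step_exists)
  show ?thesis
    unfolding angle_eq_follow[OF k(1,2)] using k assms
    by (intro follow_thin node_near_thinnest) auto
qed

text \<open>\<open>follow_lipschitz\<close> covers a single step. Induction on the number of steps
  splits at the last grid time \<open>?r\<close> and adds the two bounds.\<close>

lemma angle_lipschitz_ordered:
  assumes "0 \<le> s" "s \<le> t" "t \<le> T" "t \<le> real k / 20"
  shows "\<bar>angle P s - angle P t\<bar> \<le> 43 * (t - s)"
  using assms
proof (induction k arbitrary: s t)
  case 0
  then have "s = t" by simp
  then show ?case by simp
next
  case (Suc k)
  let ?r = "real k / 20"
  have step: "\<bar>angle P x - angle P t\<bar> \<le> 43 * (t - x)" if "?r \<le> x" "x \<le> t" for x
  proof -
    have "\<bar>follow P ?r (node P k) x - follow P ?r (node P k) t\<bar> \<le> 43 * \<bar>x - t\<bar>"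
      using that Suc.prems by (intro follow_lipschitz) auto
    then show ?thesis using that Suc.prems by (simp add: angle_eq_follow[of k])
  qed
  consider "t \<le> ?r" | "?r \<le> s" | "s < ?r" "?r < t" by linarith
  then show ?case
  proof cases
    case 3
    then show ?thesis using step[of ?r] Suc.IH[of s ?r] Suc.prems by simp
  qed (use Suc step in auto)
qed

lemma angle_lipschitz:
  assumes "s \<in> {0..T}" "t \<in> {0..T}"
  shows "\<bar>angle P s - angle P t\<bar> \<le> 43 * \<bar>s - t\<bar>"
proof -
  obtain k where "max s t * 20 \<le> real k"
    using real_arch_simple by blast
  then have "s \<le> real k / 20" "t \<le> real k / 20" by linarith+
  then show ?thesis
    using angle_lipschitz_ordered[of s t k] angle_lipschitz_ordered[of t s k] assms
    by (cases "s \<le> t") (auto simp: abs_minus_commute)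
qed

section \<open>Costs of the chaser against any competitor\<close>

lemma cost_STRIP_chaser_le:
  assumes "t \<in> {0..T}"
  shows "cost_STRIP (chaser P t) (P t) \<le> 18 * cost_STRIP \<gamma> (P t)"
proof -
  obtain \<eta> where \<gamma>: "\<gamma> = orient \<eta>" by (rule orient_cases)
  have "0 \<le> extent (dir (\<eta> + pi / 2)) (P t)"
    using extent_nonneg finite_points points_nonempty[OF assms] by simp
  then show ?thesis
    using angle_thin[OF assms, of "\<eta> + pi / 2"] assms
    by (simp add: \<gamma> cost_STRIP_def chaser_def perp_orient width_orient)
qed

text \<open>One width of the competing box is at least \<open>2 / 3\<close> of the diameter. The
  other one is compared with the thin width of the chaser at the factor 12, and the remaining width
  of the chaser is at most the diameter, so the total is \<open>12 * 3 / 2 = 18\<close>.\<close>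

lemma cost_OBB_chaser_le:
  assumes "t \<in> {0..T}"
  shows "cost_OBB (chaser P t) (P t) \<le> 18 * cost_OBB \<gamma> (P t)"
proof -
  obtain \<eta> where \<gamma>: "\<gamma> = orient \<eta>" by (rule orient_cases)
  obtain d where d: "diametral (P t) d"
    using finite_points points_nonempty[OF assms] by (rule diametral_exists)
  let ?E = "\<lambda>\<theta>. extent (dir \<theta>) (P t)" and ?D = "diameter (P t)" and ?\<phi> = "angle P t"
  have nonneg: "0 \<le> ?E \<theta>" for \<theta>
    using extent_nonneg finite_points points_nonempty[OF assms] by simp
  have "cos (d - (\<eta> + pi / 2)) = sin (d - \<eta>)"
    by (simp add: cos_diff cos_add sin_add sin_diff)
  then have E: "?D * \<bar>cos (d - \<eta>)\<bar> \<le> ?E \<eta>" "?D * \<bar>sin (d - \<eta>)\<bar> \<le> ?E (\<eta> + pi / 2)"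
    using extent_ge_diametral[OF finite_points d, of \<eta>]
      extent_ge_diametral[OF finite_points d, of "\<eta> + pi / 2"] by simp_all
  \<comment> \<open>Otherwise the squares would add up to at most \<open>8 / 9\<close>.\<close>
  have "2 / 3 \<le> \<bar>cos x\<bar> \<or> 2 / 3 \<le> \<bar>sin x\<bar>" for x :: real
  proof (rule ccontr)
    assume "\<not> ?thesis"
    then have "\<bar>cos x\<bar>\<^sup>2 \<le> (2 / 3)\<^sup>2" "\<bar>sin x\<bar>\<^sup>2 \<le> (2 / 3)\<^sup>2"
      by (intro power_mono; simp)+
    then show False using sin_cos_squared_add[of x] by (simp add: power_divide)
  qed
  then have "?D * (2 / 3) \<le> ?E \<eta> \<or> ?D * (2 / 3) \<le> ?E (\<eta> + pi / 2)"
    using E diameter_ge_1[OF assms] by (meson mult_left_mono order.trans zero_le_one)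
  then have "?D * ?E (?\<phi> + pi / 2) \<le> 18 * (?E \<eta> * ?E (\<eta> + pi / 2))"
  proof
    assume "?D * (2 / 3) \<le> ?E \<eta>"
    then have "(?D * (2 / 3)) * ?E (?\<phi> + pi / 2) \<le> ?E \<eta> * (12 * ?E (\<eta> + pi / 2))"
      using nonneg angle_thin[OF assms] by (intro mult_mono) auto
    then show ?thesis by simp
  next
    assume "?D * (2 / 3) \<le> ?E (\<eta> + pi / 2)"
    then have "(?D * (2 / 3)) * ?E (?\<phi> + pi / 2) \<le> ?E (\<eta> + pi / 2) * (12 * ?E \<eta>)"
      using nonneg angle_thin[OF assms] by (intro mult_mono) auto
    then show ?thesis by (simp add: mult.commute)
  qed
  moreover have "?E ?\<phi> * ?E (?\<phi> + pi / 2) \<le> ?D * ?E (?\<phi> + pi / 2)"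
    using extent_le_diameter[OF finite_points points_nonempty[OF assms]] nonneg
    by (intro mult_right_mono) auto
  ultimately show ?thesis
    using assms by (simp add: \<gamma> cost_OBB_def chaser_def perp_orient width_orient)
qed

lemma chaser_cost_nonneg:
  assumes "t \<in> {0..T}"
  shows "0 \<le> cost_STRIP (chaser P t) (P t)" "0 \<le> cost_OBB (chaser P t) (P t)"
proof -
  have "0 \<le> width \<alpha> (P t)" for \<alpha>
  proof -
    obtain \<theta> where "\<alpha> = orient \<theta>" by (rule orient_cases)
    then show ?thesis
      using extent_nonneg[OF finite_points points_nonempty[OF assms]] by (simp add: width_orient)
  qed
  then show "0 \<le> cost_STRIP (chaser P t) (P t)" "0 \<le> cost_OBB (chaser P t) (P t)"
    by (simp_all add: cost_STRIP_def cost_OBB_def)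
qed

end

section \<open>From cost bounds to the stability ratio\<close>

lemma lipschitz_chaser: "lipschitz_algorithm 43 chaser"
  unfolding lipschitz_algorithm_def
proof (intro allI impI ballI)
  fix T n p s t
  assume "admissible_motion T n p" and st: "s \<in> {0..T}" "t \<in> {0..T::real}"
  then interpret motion T n p by unfold_locales
  show "orientation_dist (chaser (points_at n p) s) (chaser (points_at n p) t) \<le> 43 * \<bar>s - t\<bar>"
    using order.trans[OF orientation_dist_orient_le angle_lipschitz[OF st]] st
    by (simp add: chaser_def)
qed

text \<open>\<open>f \<alpha> P / c\<close> is a lower bound of all costs, hence of their infimum.
  If the infimum is 0, so is the numerator, and \<open>1 \<le> c\<close> covers the conventional
  ratio 1.\<close>

lemma cost_ratio_le:
  assumes "0 \<le> f \<alpha> P" "\<And>\<gamma>. f \<alpha> P \<le> c * f \<gamma> P" "1 \<le> c"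
  shows "cost_ratio f \<alpha> P \<le> ereal c"
proof -
  define m where "m = (INF \<gamma>. f \<gamma> P)"
  have "f \<alpha> P / c \<le> m"
    unfolding m_def using assms by (intro cINF_greatest) (auto simp: divide_le_eq mult.commute)
  then have fm: "f \<alpha> P \<le> c * m" using assms by (simp add: divide_le_eq mult.commute)
  show ?thesis
  proof (cases "m = 0")
    case True
    then have "f \<alpha> P = 0" using fm assms by simp
    then show ?thesis using True assms by (simp add: cost_ratio_def flip: m_def)
  next
    case False
    have "0 \<le> f \<alpha> P / c" using assms by simp
    then have "0 < m" using \<open>f \<alpha> P / c \<le> m\<close> False by linarith
    then show ?thesis
      using fm by (simp add: cost_ratio_def divide_le_eq flip: m_def)
  qed
qed

text \<open>\<open>chaser\<close> is the witness for the infimum over algorithms, whichever cost is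
  considered.\<close>

lemma lipschitz_stability_ratio_le:
  assumes "1 \<le> c"
    and "\<And>T n p t. admissible_motion T n p \<Longrightarrow> t \<in> {0..T} \<Longrightarrow>
      0 \<le> f (chaser (points_at n p) t) (points_at n p t)"
    and "\<And>T n p t \<gamma>. admissible_motion T n p \<Longrightarrow> t \<in> {0..T} \<Longrightarrow>
      f (chaser (points_at n p) t) (points_at n p t) \<le> c * f \<gamma> (points_at n p t)"
  shows "lipschitz_stability_ratio f 43 \<le> ereal c"
  unfolding lipschitz_stability_ratio_def
proof (rule INF_lower2)
  show "chaser \<in> {A. state_aware A \<and> lipschitz_algorithm 43 A}"
    by (simp add: state_aware_chaser lipschitz_chaser)
  show "(SUP (T, n, p)\<in>{(T, n, p). admissible_motion T n p}.
      SUP t\<in>{0..T}. cost_ratio f (chaser (points_at n p) t) (points_at n p t)) \<le> ereal c"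
  proof (rule SUP_least)
    fix x assume "x \<in> {(T, n, p). admissible_motion T n p}"
    then obtain T n p where x: "x = (T, n, p)" "admissible_motion T n p" by auto
    show "(case x of (T, n, p) \<Rightarrow>
      SUP t\<in>{0..T}. cost_ratio f (chaser (points_at n p) t) (points_at n p t)) \<le> ereal c"
      unfolding x(1) prod.case using x(2) by (intro SUP_least cost_ratio_le assms)
  qed
qed

theorem theorem17:
  "lipschitz_stability_ratio cost_OBB 43 \<le> 18 \<and> lipschitz_stability_ratio cost_STRIP 43 \<le> 18"
proof
  have "lipschitz_stability_ratio cost_OBB 43 \<le> ereal 18"
    by (intro lipschitz_stability_ratio_le motion.cost_OBB_chaser_le motion.chaser_cost_nonneg
        motion.intro) auto
  then show "lipschitz_stability_ratio cost_OBB 43 \<le> 18" by simp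
  have "lipschitz_stability_ratio cost_STRIP 43 \<le> ereal 18"
    by (intro lipschitz_stability_ratio_le motion.cost_STRIP_chaser_le motion.chaser_cost_nonneg
        motion.intro) auto
  then show "lipschitz_stability_ratio cost_STRIP 43 \<le> 18" by simp
qed

end
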